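(* Let $\mathbb F\in\{\mathbb R,\mathbb C,\mathbb H\}$, let $1\le p<n$ and $q=n-p$. If an $\mathbb F$-$(p,n)$-fibration exists, then there exist $p$ (continuous) sections of the $\mathbb F$-tangent bundle on the unit sphere in $\mathbb F^q$ which are linearly independent over $\mathbb F$ at every point.
   Context: $|\mathbb F|=\dim_{\mathbb R}\mathbb F$. An $\mathbb F$-$(p,n)$-fibration is a continuous fibration of $\mathbb F^n$ by pairwise skew copies of $\mathbb F^p$: a family of affine $\mathbb F$-subspaces of $\mathbb F$-dimension $p$ (fibers) such that through every point of $\mathbb F^n$ passes exactly one fiber, the direction subspace of the fiber through a point depends continuously on the point, and any two distinct fibers are skew, i.e. they do not intersect and contain no common parallel direction (their direction subspaces intersect only in $0$). For $\mathbb F=\mathbb H$, $\mathbb H^n$ is regarded as a right $\mathbb H$-vector space, so that the graph of $t\mapsto Bt+y$ with $B$ a $q\times p$ quaternionic matrix is an affine $\mathbb H$-subspace. Identify $\mathbb F^q$ with $\mathbb R^{|\mathbb F|q}$ and let $\langle\cdot,\cdot\rangle$ be the induced real Euclidean inner product. The unit sphere $S^{|\mathbb F|q-1}\subset\mathbb F^q$ is the set of vectors of unit length. The $\mathbb F$-tangent space at a point $y$ of this sphere is the $\mathbb F$-subspace of dimension $q-1$ of all vectors that are $\langle\cdot,\cdot\rangle$-orthogonal to the $\mathbb F$-line spanned by $y$ (orthogonal to $y$ for $\mathbb R$; to $y$ and $iy$ for $\mathbb C$; to the quaternionic line $y\mathbb H$, spanned over $\mathbb R$ by $y$ and its multiples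 by $i,j,k$, for $\mathbb H$). These spaces form the $\mathbb F$-tangent bundle of the sphere. *)

theory Defs
  imports "HOL-Analysis.Analysis"
begin

datatype quat = Quat (qre: real) (qim1: real) (qim2: real) (qim3: real)

lemma quat_eq_iff:
  "x = y \<longleftrightarrow> qre x = qre y \<and> qim1 x = qim1 y \<and> qim2 x = qim2 y \<and> qim3 x = qim3 y"
  by (cases x; cases y) simp

instantiation quat :: ab_group_add
begin

definition zero_quat :: quat where "0 = Quat 0 0 0 0"

definition plus_quat :: "quat \<Rightarrow> quat \<Rightarrow> quat"
  where "x + y = Quat (qre x + qre y) (qim1 x + qim1 y) (qim2 x + qim2 y) (qim3 x + qim3 y)"

definition uminus_quat :: "quat \<Rightarrow> quat"
  where "- x = Quat (- qre x) (- qim1 x) (- qim2 x) (- qim3 x)"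

definition minus_quat :: "quat \<Rightarrow> quat \<Rightarrow> quat"
  where "x - y = Quat (qre x - qre y) (qim1 x - qim1 y) (qim2 x - qim2 y) (qim3 x - qim3 y)"

instance
  by standard
    (simp_all add: quat_eq_iff zero_quat_def plus_quat_def uminus_quat_def minus_quat_def)

end

lemma quat_zero_sel [simp]: "qre 0 = 0" "qim1 0 = 0" "qim2 0 = 0" "qim3 0 = 0"
  by (simp_all add: zero_quat_def)

lemma quat_plus_sel [simp]:
  "qre (x + y) = qre x + qre y" "qim1 (x + y) = qim1 x + qim1 y"
  "qim2 (x + y) = qim2 x + qim2 y" "qim3 (x + y) = qim3 x + qim3 y"
  by (simp_all add: plus_quat_def)

lemma quat_uminus_sel [simp]:
  "qre (- x) = - qre x" "qim1 (- x) = - qim1 x"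
  "qim2 (- x) = - qim2 x" "qim3 (- x) = - qim3 x"
  by (simp_all add: uminus_quat_def)

lemma quat_minus_sel [simp]:
  "qre (x - y) = qre x - qre y" "qim1 (x - y) = qim1 x - qim1 y"
  "qim2 (x - y) = qim2 x - qim2 y" "qim3 (x - y) = qim3 x - qim3 y"
  by (simp_all add: minus_quat_def)

instantiation quat :: ring_1
begin

definition one_quat :: quat where "1 = Quat 1 0 0 0"

definition times_quat :: "quat \<Rightarrow> quat \<Rightarrow> quat"
  where "x * y = Quat
    (qre x * qre y - qim1 x * qim1 y - qim2 x * qim2 y - qim3 x * qim3 y)
    (qre x * qim1 y + qim1 x * qre y + qim2 x * qim3 y - qim3 x * qim2 y)
    (qre x * qim2 y - qim1 x * qim3 y + qim2 x * qre y + qim3 x * qim1 y)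
    (qre x * qim3 y + qim1 x * qim2 y - qim2 x * qim1 y + qim3 x * qre y)"

instance
  by standard (simp_all add: quat_eq_iff one_quat_def times_quat_def algebra_simps)

end

lemma quat_one_sel [simp]: "qre 1 = 1" "qim1 1 = 0" "qim2 1 = 0" "qim3 1 = 0"
  by (simp_all add: one_quat_def)

lemma quat_times_sel [simp]:
  "qre (x * y) = qre x * qre y - qim1 x * qim1 y - qim2 x * qim2 y - qim3 x * qim3 y"
  "qim1 (x * y) = qre x * qim1 y + qim1 x * qre y + qim2 x * qim3 y - qim3 x * qim2 y"
  "qim2 (x * y) = qre x * qim2 y - qim1 x * qim3 y + qim2 x * qre y + qim3 x * qim1 y"
  "qim3 (x * y) = qre x * qim3 y + qim1 x * qim2 y - qim2 x * qim1 y + qim3 x * qre y"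
  by (simp_all add: times_quat_def)

instantiation quat :: real_algebra_1
begin

definition scaleR_quat :: "real \<Rightarrow> quat \<Rightarrow> quat"
  where "r *\<^sub>R x = Quat (r * qre x) (r * qim1 x) (r * qim2 x) (r * qim3 x)"

instance
  by standard (simp_all add: quat_eq_iff scaleR_quat_def algebra_simps)

end

lemma quat_scaleR_sel [simp]:
  "qre (r *\<^sub>R x) = r * qre x" "qim1 (r *\<^sub>R x) = r * qim1 x"
  "qim2 (r *\<^sub>R x) = r * qim2 x" "qim3 (r *\<^sub>R x) = r * qim3 x"
  by (simp_all add: scaleR_quat_def)

instantiation quat :: real_inner
begin

definition inner_quat :: "quat \<Rightarrow> quat \<Rightarrow> real"
  where "x \<bullet> y = qre x * qre y + qim1 x * qim1 y + qim2 x * qim2 y + qim3 x * qim3 y"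

definition norm_quat :: "quat \<Rightarrow> real"
  where "norm x = sqrt ((qre x)\<^sup>2 + (qim1 x)\<^sup>2 + (qim2 x)\<^sup>2 + (qim3 x)\<^sup>2)"

definition sgn_quat :: "quat \<Rightarrow> quat"
  where "sgn x = x /\<^sub>R norm x" for x :: quat

definition dist_quat :: "quat \<Rightarrow> quat \<Rightarrow> real"
  where "dist x y = norm (x - y)" for x y :: quat

definition uniformity_quat :: "(quat \<times> quat) filter"
  where [code del]: "(uniformity :: (quat \<times> quat) filter) = (INF e\<in>{0 <..}. principal {(x, y). dist x y < e})"

definition open_quat :: "quat set \<Rightarrow> bool"
  where [code del]:
    "open (U :: quat set) \<longleftrightarrow> (\<forall>x\<in>U. eventually (\<lambda>(x', y). x' = x \<longrightarrow> y \<in> U) uniformity)"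

instance
proof
  fix x y z :: quat and r :: real
  show "x \<bullet> y = y \<bullet> x"
    by (simp add: inner_quat_def mult.commute)
  show "(x + y) \<bullet> z = x \<bullet> z + y \<bullet> z"
    by (simp add: inner_quat_def algebra_simps)
  show "(r *\<^sub>R x) \<bullet> y = r * (x \<bullet> y)"
    by (simp add: inner_quat_def algebra_simps)
  show "0 \<le> x \<bullet> x"
    by (simp add: inner_quat_def)
  show "x \<bullet> x = 0 \<longleftrightarrow> x = 0"
    by (simp add: inner_quat_def quat_eq_iff add_nonneg_eq_0_iff)
  show "norm x = sqrt (x \<bullet> x)"
    by (simp add: inner_quat_def norm_quat_def power2_eq_square)
qed (rule sgn_quat_def dist_quat_def open_quat_def uniformity_quat_def)+

end

instantiation quat :: real_normed_div_algebra
begin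

definition inverse_quat :: "quat \<Rightarrow> quat"
  where "inverse x = Quat (qre x) (- qim1 x) (- qim2 x) (- qim3 x) /\<^sub>R (norm x)\<^sup>2"

definition divide_quat :: "quat \<Rightarrow> quat \<Rightarrow> quat"
  where "x div y = x * inverse y" for x y :: quat

instance
proof
  fix x y :: quat
  have n2: "(norm x)\<^sup>2 = (qre x)\<^sup>2 + (qim1 x)\<^sup>2 + (qim2 x)\<^sup>2 + (qim3 x)\<^sup>2" for x :: quat
    by (simp add: norm_quat_def)
  define c where "c x = Quat (qre x) (- qim1 x) (- qim2 x) (- qim3 x)" for x
  have c: "c x * x = (norm x)\<^sup>2 *\<^sub>R 1" "x * c x = (norm x)\<^sup>2 *\<^sub>R 1"
    unfolding n2 by (simp_all add: c_def quat_eq_iff power2_eq_square algebra_simps)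
  have i: "inverse x = c x /\<^sub>R (norm x)\<^sup>2"
    by (simp add: inverse_quat_def c_def)
  show "x \<noteq> 0 \<Longrightarrow> inverse x * x = 1" "x \<noteq> 0 \<Longrightarrow> x * inverse x = 1"
    by (simp_all add: i c)
  show "x div y = x * inverse y"
    by (rule divide_quat_def)
  show "inverse (0::quat) = 0"
    by (simp add: inverse_quat_def)
  have "(norm (x * y))\<^sup>2 = (norm x * norm y)\<^sup>2"
    unfolding n2 power_mult_distrib quat_times_sel by algebra
  then show "norm (x * y) = norm x * norm y"
    by (simp add: power2_eq_iff_nonneg)
qed

end

definition qi :: quat where "qi = Quat 0 1 0 0"
definition qj :: quat where "qj = Quat 0 0 1 0"
definition qk :: quat where "qk = Quat 0 0 0 1"

lemma quat_units:
  "qi * qi = -1" "qj * qj = -1" "qk * qk = -1"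
  "qi * qj = qk" "qj * qk = qi" "qk * qi = qj"
  "qj * qi = - qk" "qk * qj = - qi" "qi * qk = - qj"
  by (simp_all add: quat_eq_iff qi_def qj_def qk_def)

instantiation quat :: euclidean_space
begin

definition Basis_quat :: "quat set" where "Basis = {1, qi, qj, qk}"

instance
proof
  show "(Basis :: quat set) \<noteq> {}" "finite (Basis :: quat set)"
    by (simp_all add: Basis_quat_def)
next
  fix u v :: quat
  assume "u \<in> Basis" "v \<in> Basis"
  then show "u \<bullet> v = (if u = v then 1 else 0)"
    unfolding Basis_quat_def
    by (elim insertE emptyE)
      (simp_all add: inner_quat_def qi_def qj_def qk_def one_quat_def)
next
  fix x :: quat
  show "(\<forall>u\<in>Basis. x \<bullet> u = 0) \<longleftrightarrow> x = 0"
    unfolding quat_eq_iff[of x 0]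
    by (auto simp: Basis_quat_def inner_quat_def qi_def qj_def qk_def)
qed

end

text \<open>
  Every notion below is polymorphic in the scalars and is used only at the types
  \<^typ>\<open>real\<close>, \<^typ>\<open>complex\<close> and \<^typ>\<open>quat\<close>. The library's \<^locale>\<open>vector_space\<close> requires
  commutative scalars, so linear algebra with scalars acting on the right is set up by hand.
\<close>

definition rscale :: "'f::times ^ 'n \<Rightarrow> 'f \<Rightarrow> 'f ^ 'n"  (infixl "*r" 75)
  where "x *r c = (\<chi> i. x $ i * c)"

definition rsubspace :: "('f::division_ring ^ 'n) set \<Rightarrow> bool"
  where "rsubspace V \<longleftrightarrow>
    0 \<in> V \<and> (\<forall>x\<in>V. \<forall>y\<in>V. x + y \<in> V) \<and> (\<forall>x\<in>V. \<forall>c. x *r c \<in> V)"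

definition rindependent :: "nat \<Rightarrow> (nat \<Rightarrow> 'f::division_ring ^ 'n) \<Rightarrow> bool"
  where "rindependent p b \<longleftrightarrow>
    (\<forall>c. (\<Sum>i<p. b i *r c i) = 0 \<longrightarrow> (\<forall>i<p. c i = 0))"

definition rspan :: "nat \<Rightarrow> (nat \<Rightarrow> 'f::division_ring ^ 'n) \<Rightarrow> ('f ^ 'n) set"
  where "rspan p b = {\<Sum>i<p. b i *r c i | c. True}"

definition rsubspace_of_dim :: "nat \<Rightarrow> ('f::division_ring ^ 'n) set \<Rightarrow> bool"
  where "rsubspace_of_dim p V \<longleftrightarrow>
    rsubspace V \<and> (\<exists>b. rindependent p b \<and> rspan p b = V)"

definition raffine_of_dim :: "nat \<Rightarrow> ('f::division_ring ^ 'n) set \<Rightarrow> bool"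
  where "raffine_of_dim p A \<longleftrightarrow> (\<exists>a V. rsubspace_of_dim p V \<and> A = (+) a ` V)"

definition direction :: "('a::ab_group_add) set \<Rightarrow> 'a set"
  where "direction A = {x - y | x y. x \<in> A \<and> y \<in> A}"

lemma direction_translate_rsubspace:
  assumes "rsubspace V"
  shows "direction ((+) a ` V) = V"
proof -
  have m: "x - y \<in> V" if "x \<in> V" "y \<in> V" for x y
  proof -
    have "x + y *r (- 1) \<in> V"
      using assms that by (simp add: rsubspace_def)
    moreover have "x + y *r (- 1) = x - y"
      by (simp add: rscale_def vec_eq_iff)
    ultimately show ?thesis by simp
  qed
  have "v \<in> direction ((+) a ` V)" if "v \<in> V" for v
    unfolding direction_def
  proof -
    have "a + v \<in> (+) a ` V" "a + 0 \<in> (+) a ` V"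
      using that assms unfolding rsubspace_def by blast+
    moreover have "v = (a + v) - (a + 0)"
      by simp
    ultimately show "v \<in> {x - y |x y. x \<in> (+) a ` V \<and> y \<in> (+) a ` V}"
      by blast
  qed
  then show ?thesis
    using m by (auto simp: direction_def)
qed

text \<open>
  The topology on the Grassmannian is that of the metric
  \<open>\<parallel>P\<^sub>V - P\<^sub>W\<parallel>\<close> (operator norm), where \<open>P\<^sub>V\<close> is the orthogonal projection onto the linear
  subspace \<open>V\<close>; on linear subspaces it is given by \<^const>\<open>closest_point\<close>.
\<close>

definition subspace_dist :: "('a::euclidean_space) set \<Rightarrow> 'a set \<Rightarrow> real"
  where "subspace_dist V W = onorm (\<lambda>v. closest_point V v - closest_point W v)"

definition fiber_at :: "'a set set \<Rightarrow> 'a \<Rightarrow> 'a set"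
  where "fiber_at \<F> x = (THE A. A \<in> \<F> \<and> x \<in> A)"

definition skew :: "('a::ab_group_add) set \<Rightarrow> 'a set \<Rightarrow> bool"
  where "skew A B \<longleftrightarrow> A \<inter> B = {} \<and> direction A \<inter> direction B = {0}"

definition skew_fibration ::
    "nat \<Rightarrow> ('f::{real_normed_div_algebra, euclidean_space} ^ 'n) set set \<Rightarrow> bool"
  where "skew_fibration p \<F> \<longleftrightarrow>
    (\<forall>A\<in>\<F>. raffine_of_dim p A) \<and>
    (\<forall>x. \<exists>!A. A \<in> \<F> \<and> x \<in> A) \<and>
    (\<forall>x. ((\<lambda>y. subspace_dist (direction (fiber_at \<F> y)) (direction (fiber_at \<F> x)))
            \<longlongrightarrow> 0) (at x)) \<and>
    (\<forall>A\<in>\<F>. \<forall>B\<in>\<F>. A \<noteq> B \<longrightarrow> skew A B)"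

definition sphere_tangent_space ::
    "'f::{real_normed_div_algebra, euclidean_space} ^ 'q \<Rightarrow> ('f ^ 'q) set"
  where "sphere_tangent_space y = {v. \<forall>c. v \<bullet> (y *r c) = 0}"

definition sphere_tangent_section ::
    "('f::{real_normed_div_algebra, euclidean_space} ^ 'q \<Rightarrow> 'f ^ 'q) \<Rightarrow> bool"
  where "sphere_tangent_section s \<longleftrightarrow>
    continuous_on (sphere 0 1) s \<and> (\<forall>y\<in>sphere 0 1. s y \<in> sphere_tangent_space y)"

definition independent_sphere_tangent_sections ::
    "nat \<Rightarrow> (nat \<Rightarrow> 'f::{real_normed_div_algebra, euclidean_space} ^ 'q \<Rightarrow> 'f ^ 'q) \<Rightarrow> bool"
  where "independent_sphere_tangent_sections p s \<longleftrightarrow>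
    (\<forall>i<p. sphere_tangent_section (s i)) \<and>
    (\<forall>y\<in>sphere 0 1. rindependent p (\<lambda>i. s i y))"

end

theory Submission
  imports Defs
begin

text \<open>
  Split \<open>F\<^sup>n\<close> as \<open>V \<oplus> L(F\<^sup>q)\<close>, where \<open>V\<close> is the fiber through \<open>0\<close>, and let \<open>\<pi>\<close> be the
  projection to \<open>F\<^sup>q\<close> along \<open>V\<close>. The orthogonal projections of a basis of \<open>V\<close> to the direction of
  the fiber through \<open>L y\<close> depend continuously on \<open>y\<close> and remain independent for small \<open>y\<close>. For
  \<open>y \<noteq> 0\<close> the two fibers are skew: the directions meet only in \<open>0\<close>, so \<open>\<pi>\<close> keeps the projected
  vectors independent, and the fibers are disjoint, so \<open>y\<close> is not in the span of their images. On
  a small sphere one thus has \<open>p\<close> vectors that are independent together with \<open>y\<close>; their components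
  orthogonal to the line \<open>yF\<close> are the sections.
\<close>

section \<open>The right action of scalars and projection off a line\<close>

lemma rscale_nth: "(x *r c) $ i = x $ i * c"
  by (simp add: rscale_def)

lemma norm_rscale:
  fixes x :: "'f::real_normed_div_algebra ^ 'n"
  shows "norm (x *r c) = norm x * norm c"
  by (simp add: norm_vec_def rscale_def norm_mult L2_set_left_distrib)

text \<open>Interpreting \<open>bounded_bilinear\<close> supplies additivity, sums, real scaling and
  continuity of the right action in one stroke.\<close>

lemma bounded_bilinear_rscale:
  "bounded_bilinear ((*r) :: 'f::real_normed_div_algebra ^ 'n \<Rightarrow> 'f \<Rightarrow> 'f ^ 'n)"
proof
  show "\<exists>K. \<forall>(a :: 'f ^ 'n) (b :: 'f). norm (a *r b) \<le> norm a * norm b * K"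
    by (intro exI[of _ 1]) (simp add: norm_rscale)
qed (simp_all add: rscale_def vec_eq_iff algebra_simps)

interpretation rscale: bounded_bilinear "(*r) :: 'f::real_normed_div_algebra ^ 'n \<Rightarrow> 'f \<Rightarrow> 'f ^ 'n"
  by (rule bounded_bilinear_rscale)

lemma rscale_rscale: "(x *r c) *r d = x *r (c * d)"
  for x :: "'f::division_ring ^ 'n"
  by (simp add: rscale_def vec_eq_iff mult.assoc)

lemma rscale_one [simp]: "x *r 1 = x"
  for x :: "'f::division_ring ^ 'n"
  by (simp add: rscale_def vec_eq_iff)

lemma rscale_of_real: "x *r of_real r = r *\<^sub>R x"
  for x :: "'f::real_normed_div_algebra ^ 'n"
  by (simp add: of_real_def rscale.scaleR_right)

text \<open>By \<open>norm_rscale\<close>, acting on y multiplies norms by the constant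
  \<open>norm y\<close>; polarization carries this over to inner products.\<close>

lemma inner_rscale_rscale:
  fixes y :: "'f::{real_normed_div_algebra, euclidean_space} ^ 'n"
  shows "(y *r c) \<bullet> (y *r d) = (norm y)\<^sup>2 * (c \<bullet> d)"
  by (simp add: dot_norm norm_rscale power_mult_distrib right_diff_distrib diff_divide_distrib
      flip: rscale.add_right)

text \<open>For a unit vector y the products \<open>y *r e\<close> with e in \<open>Basis\<close>
  are orthonormal, so \<open>y *r rline_coeff y v\<close> is the orthogonal projection of v to the
  line yF. Real inner products treat all three scalar types alike, without conjugation.\<close>

definition rline_coeff :: "'f::{real_normed_div_algebra, euclidean_space} ^ 'n \<Rightarrow> 'f ^ 'n \<Rightarrow> 'f"
  where "rline_coeff y v = (\<Sum>e\<in>Basis. (v \<bullet> (y *r e)) *\<^sub>R e)"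

lemma diff_rline_coeff_tangent:
  fixes y v :: "'f::{real_normed_div_algebra, euclidean_space} ^ 'n"
  assumes "norm y = 1"
  shows "v - y *r rline_coeff y v \<in> sphere_tangent_space y"
proof -
  have "(y *r rline_coeff y v) \<bullet> (y *r c) = v \<bullet> (y *r c)" for c
  proof -
    have "(y *r rline_coeff y v) \<bullet> (y *r c) = rline_coeff y v \<bullet> c"
      by (simp add: inner_rscale_rscale assms)
    \<comment> \<open>Both sides are the sum of
      \<open>(v \<bullet> (y *r e)) * (c \<bullet> e)\<close> over the real basis.\<close>
    also have "\<dots> = v \<bullet> (y *r (\<Sum>e\<in>Basis. (c \<bullet> e) *\<^sub>R e))"
      by (simp add: rline_coeff_def inner_sum_left rscale.sum_right rscale.scaleR_right
          inner_sum_right inner_commute[of c] mult.commute)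
    finally show ?thesis
      by (simp add: euclidean_representation)
  qed
  then show ?thesis
    by (simp add: sphere_tangent_space_def inner_diff_left)
qed

lemma continuous_on_rline_coeff:
  assumes "continuous_on S f"
  shows "continuous_on S (\<lambda>y. rline_coeff y (f y))"
  unfolding rline_coeff_def
  by (intro continuous_intros rscale.continuous_on assms)

section \<open>Right subspaces, spans and bases\<close>

lemma sum_rscale_in_rsubspace:
  fixes m :: nat
  assumes "rsubspace V" "\<And>i. i < m \<Longrightarrow> u i \<in> V"
  shows "(\<Sum>i<m. u i *r c i) \<in> V"
proof -
  have "k \<le> m \<Longrightarrow> (\<Sum>i<k. u i *r c i) \<in> V" for k
    by (induction k) (use assms in \<open>simp_all add: rsubspace_def\<close>)
  then show ?thesis by simp
qed

lemma subspace_rsubspace: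
  fixes V :: "('f::real_normed_div_algebra ^ 'n) set"
  assumes "rsubspace V"
  shows "subspace V"
  using assms unfolding rsubspace_def subspace_def by (metis rscale_of_real)

lemma rsubspace_rspan: "rsubspace (rspan m b)"
  for b :: "nat \<Rightarrow> 'f::real_normed_div_algebra ^ 'n"
  unfolding rsubspace_def rspan_def
proof (intro conjI ballI allI)
  show "0 \<in> {\<Sum>i<m. b i *r c i |c. True}"
    by (auto intro!: exI[of _ "\<lambda>_. 0"] simp: rscale.zero_right)
next
  fix x y assume "x \<in> {\<Sum>i<m. b i *r c i |c. True}" "y \<in> {\<Sum>i<m. b i *r c i |c. True}"
  then obtain c d where "x = (\<Sum>i<m. b i *r c i)" "y = (\<Sum>i<m. b i *r d i)" by blast
  then show "x + y \<in> {\<Sum>i<m. b i *r c i |c. True}"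
    by (auto intro!: exI[of _ "\<lambda>i. c i + d i"] simp: rscale.add_right sum.distrib)
next
  fix x and e :: 'f assume "x \<in> {\<Sum>i<m. b i *r c i |c. True}"
  then obtain c where "x = (\<Sum>i<m. b i *r c i)" by blast
  then show "x *r e \<in> {\<Sum>i<m. b i *r c i |c. True}"
    by (auto intro!: exI[of _ "\<lambda>i. c i * e"] simp: rscale.sum_left rscale_rscale)
qed

lemma rspan_base:
  fixes b :: "nat \<Rightarrow> 'f::real_normed_div_algebra ^ 'n"
  assumes "i < m"
  shows "b i \<in> rspan m b"
proof -
  have "(\<Sum>j<m. b j *r (if j = i then 1 else 0)) = b i"
    using assms by (simp add: if_distrib[of "\<lambda>c. _ *r c"] rscale.zero_right cong: if_cong)
  then have "b i = (\<Sum>j<m. b j *r (if j = i then 1 else 0))" ..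
  then show ?thesis
    unfolding rspan_def by (intro CollectI exI conjI TrueI)
qed

text \<open>The products \<open>b i *r e\<close>, with e in the real basis of the scalars, form a
  real basis of the span. Dimension counts over F thus reduce to real ones.\<close>

lemma dim_rspan:
  fixes b :: "nat \<Rightarrow> 'f::{real_normed_div_algebra, euclidean_space} ^ 'n"
  assumes "rindependent m b"
  shows "dim (rspan m b) = m * DIM('f)"
proof -
  let ?I = "{..<m} \<times> (Basis :: 'f set)"
  let ?f = "\<lambda>(i, e). b i *r e"
  have sum_f: "(\<Sum>z\<in>?I. c z *\<^sub>R ?f z) = (\<Sum>i<m. b i *r (\<Sum>e\<in>Basis. c (i, e) *\<^sub>R e))" for c
    by (simp add: sum.cartesian_product' rscale.sum_right rscale.scaleR_right)
  have zero: "\<forall>z\<in>?I. c z = 0" if "(\<Sum>z\<in>?I. c z *\<^sub>R ?f z) = 0" for c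
  proof (clarsimp, rule ccontr)
    fix i and e :: 'f assume "i < m" "e \<in> Basis" "c (i, e) \<noteq> 0"
    have "(\<Sum>e\<in>Basis. c (i, e) *\<^sub>R e) = 0"
      using assms that \<open>i < m\<close> unfolding sum_f rindependent_def
      by (elim allE[of _ "\<lambda>i. \<Sum>e\<in>Basis. c (i, e) *\<^sub>R e"]) auto
    then have "(\<Sum>e\<in>Basis. c (i, e) *\<^sub>R e) \<bullet> e = 0" by simp
    then show False
      using \<open>e \<in> Basis\<close> \<open>c (i, e) \<noteq> 0\<close> by simp
  qed
  have inj: "inj_on ?f ?I"
  proof (rule inj_onI, rule ccontr)
    fix z w assume zw: "z \<in> ?I" "w \<in> ?I" "?f z = ?f w" "z \<noteq> w"
    \<comment> \<open>The coincidence is read as a real relation with coefficients 1 at z and -1 at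
      w, which \<open>zero\<close> rules out.\<close>
    let ?c = "\<lambda>v. (if v = z then 1 else 0) - (if v = w then 1 else (0::real))"
    have "(\<Sum>v\<in>?I. ?c v *\<^sub>R ?f v) = ?f z - ?f w"
      using zw(1,2) by (simp add: scaleR_diff_left sum_subtractf if_distrib[of "\<lambda>r. r *\<^sub>R _"] cong: if_cong)
    then have "\<forall>v\<in>?I. ?c v = 0"
      by (intro zero) (simp only: zw(3) diff_self)
    then have "?c z = 0"
      using zw(1) by (rule bspec)
    then show False using zw(4) by simp
  qed
  have indep: "independent (?f ` ?I)"
  proof (rule independent_if_scalars_zero)
    show "finite (?f ` ?I)" by simp
    fix g x assume "(\<Sum>x\<in>?f ` ?I. g x *\<^sub>R x) = 0" "x \<in> ?f ` ?I"
    then show "g x = 0"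
      using zero[of "g \<circ> ?f"] by (auto simp: sum.reindex[OF inj] o_def)
  qed
  have "span (?f ` ?I) = rspan m b"
  proof
    show "span (?f ` ?I) \<subseteq> rspan m b"
      using rspan_base[of _ m b] rsubspace_rspan[of m b]
      by (intro span_minimal subspace_rsubspace) (auto simp: rsubspace_def)
    show "rspan m b \<subseteq> span (?f ` ?I)"
    proof
      fix x assume "x \<in> rspan m b"
      then obtain c where x: "x = (\<Sum>i<m. b i *r c i)" by (auto simp: rspan_def)
      have "x = (\<Sum>z\<in>?I. (c (fst z) \<bullet> snd z) *\<^sub>R ?f z)"
        unfolding sum_f x by (simp add: euclidean_representation)
      also have "\<dots> \<in> span (?f ` ?I)"
        by (intro span_sum span_scale span_base imageI)
      finally show "x \<in> span (?f ` ?I)" .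
    qed
  qed
  then have "dim (rspan m b) = card (?f ` ?I)"
    by (metis dim_span_eq_card_independent indep)
  then show ?thesis
    by (simp add: card_image[OF inj])
qed

text \<open>A relation with nonzero coefficient at v could be multiplied on the right by the inverse
  of that coefficient, putting v into the span.\<close>

lemma rindependent_extend:
  fixes b :: "nat \<Rightarrow> 'f::real_normed_div_algebra ^ 'n"
  assumes "rindependent m b" "v \<notin> rspan m b"
  shows "rindependent (Suc m) (b(m := v))"
  unfolding rindependent_def
proof (intro allI impI)
  fix c i assume "(\<Sum>i<Suc m. (b(m := v)) i *r c i) = 0" and i: "i < Suc m"
  then have 0: "(\<Sum>i<m. b i *r c i) + v *r c m = 0" by simp
  have "c m = 0"
  proof (rule ccontr)
    assume "c m \<noteq> 0"
    have "v *r c m = (\<Sum>i<m. b i *r (- c i))"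
      using 0 by (simp add: rscale.minus_right sum_negf eq_neg_iff_add_eq_0 add.commute)
    then have "v *r c m \<in> rspan m b" by (auto simp: rspan_def)
    then have "(v *r c m) *r inverse (c m) \<in> rspan m b"
      using rsubspace_rspan[of m b] by (auto simp: rsubspace_def)
    then show False
      using assms(2) \<open>c m \<noteq> 0\<close> by (simp add: rscale_rscale)
  qed
  then show "c i = 0"
    using 0 assms(1) i by (auto simp: rindependent_def rscale.zero_right less_Suc_eq)
qed

text \<open>As long as m is below \<open>CARD('n)\<close>, the span has too small a real dimension
  to be everything, so a further vector can be adjoined; at \<open>CARD('n)\<close> the real
  dimensions agree and the span is full.\<close>

lemma rindependent_extend_basis:
  fixes b :: "nat \<Rightarrow> 'f::{real_normed_div_algebra, euclidean_space} ^ 'n"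
  assumes "rindependent p b" "p \<le> CARD('n)"
  obtains b' where "\<And>i. i < p \<Longrightarrow> b' i = b i" "rindependent CARD('n) b'"
    "rspan CARD('n) b' = UNIV"
proof -
  have "\<exists>b'. (\<forall>i<p. b' i = b i) \<and> rindependent m b'" if "p \<le> m" "m \<le> CARD('n)" for m
    using that
  proof (induction m rule: dec_induct)
    case base
    then show ?case using assms(1) by blast
  next
    case (step m)
    then obtain b' where b': "\<forall>i<p. b' i = b i" "rindependent m b'" by auto
    have "dim (rspan m b') < dim (UNIV :: ('f ^ 'n) set)"
      using step by (simp add: dim_rspan[OF b'(2)])
    then obtain v where "v \<notin> rspan m b'"
      by (metis UNIV_eq_I less_irrefl)
    from rindependent_extend[OF b'(2) this] b'(1) \<open>p \<le> m\<close> show ?case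
      by (intro exI[of _ "b'(m := v)"]) (simp del: fun_upd_apply add: fun_upd_other)
  qed
  then obtain b' where b': "\<forall>i<p. b' i = b i" "rindependent CARD('n) b'"
    using assms(2) by blast
  have "dim (rspan CARD('n) b') = dim (UNIV :: ('f ^ 'n) set)"
    by (simp add: dim_rspan[OF b'(2)])
  then have "rspan CARD('n) b' = UNIV"
    using subspace_rsubspace[OF rsubspace_rspan[of "CARD('n)" b']]
    by (metis dim_eq_full span_eq_iff dim_UNIV)
  with b' that show ?thesis by blast
qed

section \<open>Coordinates in a basis and stability of independence\<close>

definition rcoord :: "nat \<Rightarrow> (nat \<Rightarrow> 'f::division_ring ^ 'n) \<Rightarrow> 'f ^ 'n \<Rightarrow> nat \<Rightarrow> 'f"
  where "rcoord m b x = (SOME c. x = (\<Sum>i<m. b i *r c i))"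

context
  fixes m :: nat and b :: "nat \<Rightarrow> 'f::{real_normed_div_algebra, euclidean_space} ^ 'n"
  assumes indep: "rindependent m b" and span: "rspan m b = UNIV"
begin

lemma sum_rcoord: "(\<Sum>i<m. b i *r rcoord m b x i) = x"
proof -
  have "x \<in> rspan m b" by (simp add: span)
  then have "\<exists>c. x = (\<Sum>i<m. b i *r c i)" by (auto simp: rspan_def)
  from someI_ex[OF this] show ?thesis
    by (simp add: rcoord_def)
qed

text \<open>The chosen coefficient function is arbitrary from m on, hence the bound on i. Below m,
  the difference of two representations is a relation among the b i.\<close>

lemma rcoord_unique:
  assumes "(\<Sum>i<m. b i *r c i) = x" "i < m"
  shows "rcoord m b x i = c i"
proof -
  have "(\<Sum>i<m. b i *r (rcoord m b x i - c i)) = 0"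
    by (simp add: rscale.diff_right sum_subtractf sum_rcoord assms(1))
  with indep have "\<forall>i<m. rcoord m b x i - c i = 0"
    unfolding rindependent_def by (elim allE[of _ "\<lambda>i. rcoord m b x i - c i"]) simp
  then show ?thesis
    using assms(2) by simp
qed

lemma rcoord_add: "i < m \<Longrightarrow> rcoord m b (x + y) i = rcoord m b x i + rcoord m b y i"
  by (rule rcoord_unique) (simp_all add: rscale.add_right sum.distrib sum_rcoord)

lemma rcoord_rscale: "i < m \<Longrightarrow> rcoord m b (x *r c) i = rcoord m b x i * c"
  by (rule rcoord_unique) (simp_all add: rscale_rscale[symmetric] rscale.sum_left[symmetric] sum_rcoord)

text \<open>The right action of \<open>of_real r\<close> is real scaling, and a real linear map on a
  finite-dimensional space is bounded.\<close>

lemma bounded_linear_rcoord: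
  assumes "i < m"
  shows "bounded_linear (\<lambda>x. rcoord m b x i)"
proof -
  have "linear (\<lambda>x. rcoord m b x i)"
    using rcoord_rscale[OF assms, of _ "of_real _"]
    by (intro linearI) (simp_all add: rcoord_add[OF assms] rscale_of_real of_real_def rscale.scaleR_right)
  then show ?thesis
    by (simp add: linear_conv_bounded_linear)
qed

end

text \<open>
  Since \<open>t\<^sub>i\<close> is a coordinate of \<open>\<Sum>\<^sub>j b\<^sub>j t\<^sub>j = \<Sum>\<^sub>j (b\<^sub>j - u\<^sub>j) t\<^sub>j\<close>, it is bounded by a small
  multiple of \<open>\<Sum>\<^sub>j \<parallel>t\<^sub>j\<parallel>\<close>.
\<close>

lemma rindependent_perturb:
  fixes b :: "nat \<Rightarrow> 'f::{real_normed_div_algebra, euclidean_space} ^ 'n"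
  assumes b: "rindependent m b" "rspan m b = UNIV" and "p \<le> m"
  obtains e where "e > 0" "\<And>u. (\<And>i. i < p \<Longrightarrow> norm (b i - u i) < e) \<Longrightarrow> rindependent p u"
proof -
  have "\<forall>i. \<exists>K. i < m \<longrightarrow> (\<forall>x. norm (rcoord m b x i) \<le> norm x * K)"
    using bounded_linear.bounded[OF bounded_linear_rcoord[OF b]] by blast
  then have "\<exists>K. \<forall>i. i < m \<longrightarrow> (\<forall>x. norm (rcoord m b x i) \<le> norm x * K i)"
    by (rule choice)
  then obtain K where K: "\<And>i x. i < m \<Longrightarrow> norm (rcoord m b x i) \<le> norm x * K i" by blast
  \<comment> \<open>The summand 1 makes S positive and leaves a gap: the bounds on
    \<open>norm (t j)\<close> will sum to \<open>T \<le> T / S * (S - 1) = T - T / S\<close>, which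
    forces T = 0.\<close>
  define S where "S = (\<Sum>i<p. \<bar>K i\<bar>) + 1"
  have S: "S > 0" unfolding S_def by (smt (verit) sum_nonneg abs_ge_zero)
  show ?thesis
  proof (rule that[of "1 / S"])
    show "1 / S > 0" using S by simp
    fix u assume u: "\<And>i. i < p \<Longrightarrow> norm (b i - u i) < 1 / S"
    show "rindependent p u"
      unfolding rindependent_def
    proof (intro allI impI)
      fix t i assume ut: "(\<Sum>i<p. u i *r t i) = 0" and "i < p"
      define T where "T = (\<Sum>j<p. norm (t j))"
      define x where "x = (\<Sum>j<p. b j *r t j)"
      have T0: "T \<ge> 0" by (simp add: T_def sum_nonneg)
      have "x = (\<Sum>j<p. (b j - u j) *r t j)"
        by (simp add: x_def rscale.diff_left sum_subtractf ut)
      then have "norm x \<le> (\<Sum>j<p. norm (b j - u j) * norm (t j))"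
        using norm_sum by (metis (no_types, lifting) norm_rscale sum.cong)
      also have "\<dots> \<le> (\<Sum>j<p. 1 / S * norm (t j))"
        by (intro sum_mono mult_right_mono) (auto intro: less_imp_le u)
      finally have nx: "norm x \<le> T / S"
        by (simp add: T_def sum_divide_distrib)
      \<comment> \<open>Padding with zeros from p up to m exhibits the t j as coordinates of x in
        the full basis.\<close>
      have x_eq: "(\<Sum>j<m. b j *r (if j < p then t j else 0)) = x"
        unfolding x_def
        by (intro sum.mono_neutral_cong_right) (use \<open>p \<le> m\<close> in \<open>auto simp: rscale.zero_right\<close>)
      have t: "norm (t j) \<le> T / S * \<bar>K j\<bar>" if "j < p" for j
      proof -
        have "norm (t j) \<le> norm x * K j"
          using rcoord_unique[OF b x_eq, of j] K[of j x] that \<open>p \<le> m\<close> by simp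
        also have "\<dots> \<le> norm x * \<bar>K j\<bar>" by (intro mult_left_mono) auto
        also have "\<dots> \<le> T / S * \<bar>K j\<bar>" using nx by (intro mult_right_mono) auto
        finally show ?thesis .
      qed
      have "T \<le> (\<Sum>j<p. T / S * \<bar>K j\<bar>)"
        unfolding T_def by (intro sum_mono) (use t in \<open>auto simp: T_def\<close>)
      also have "\<dots> = T / S * (S - 1)"
        by (simp add: S_def sum_distrib_left)
      also have "\<dots> = T - T / S"
        using S by (simp add: field_simps)
      finally have "T \<le> 0"
        using S by (simp add: field_simps)
      then have "T = 0" using T0 by simp
      then show "t i = 0"
        using \<open>i < p\<close> unfolding T_def by (subst (asm) sum_nonneg_eq_0_iff) auto
    qed
  qed
qed

section \<open>Orthogonal projections and affine fibers\<close>

lemma closest_point_subspace_eqI: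
  fixes V :: "'a::euclidean_space set"
  assumes V: "subspace V" and "y \<in> V" and "\<And>w. w \<in> V \<Longrightarrow> (x - y) \<bullet> w = 0"
  shows "closest_point V x = y"
proof -
  have "dist x y \<le> dist x z" if "z \<in> V" for z
  proof -
    \<comment> \<open>By Pythagoras no point z of V is closer to x than y.\<close>
    have "(x - y) \<bullet> (y - z) = 0"
      using assms that by (simp add: subspace_diff)
    moreover have "x - z = (x - y) + (y - z)" by simp
    ultimately have "(norm (x - z))\<^sup>2 = (norm (x - y))\<^sup>2 + (norm (y - z))\<^sup>2"
      by (metis norm_add_Pythagorean orthogonal_def)
    then show ?thesis
      unfolding dist_norm by (smt (verit) power2_le_imp_le norm_ge_zero zero_le_power2)
  qed
  then show ?thesis
    using closest_point_unique[OF subspace_imp_convex[OF V] closed_subspace[OF V] \<open>y \<in> V\<close>, of x]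
    by simp
qed

text \<open>The residual is orthogonal to V, and this property determines the closest point; it is
  preserved by sums and real multiples.\<close>

lemma bounded_linear_closest_point:
  fixes V :: "'a::euclidean_space set"
  assumes V: "subspace V"
  shows "bounded_linear (closest_point V)"
proof -
  have ne: "V \<noteq> {}" and cl: "closed V"
    using V subspace_0 closed_subspace by blast+
  have mem: "closest_point V x \<in> V" for x
    by (rule closest_point_in_set[OF cl ne])
  have orth: "(x - closest_point V x) \<bullet> w = 0" if "w \<in> V" for x w
  proof -
    \<comment> \<open>The variational inequality at a closest point is one-sided; using it for w and
      -w gives equality.\<close>
    have le: "(x - closest_point V x) \<bullet> w \<le> 0" if "w \<in> V" for w
      using closest_point_dot[OF subspace_imp_convex[OF V] cl, of "closest_point V x + w" x]
        subspace_add[OF V mem that] by simp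
    from le[OF that] le[OF subspace_neg[OF V that]] show ?thesis by simp
  qed
  have "linear (closest_point V)"
  proof (rule linearI)
    fix x y
    show "closest_point V (x + y) = closest_point V x + closest_point V y"
      using orth[of _ x] orth[of _ y]
      by (intro closest_point_subspace_eqI[OF V] subspace_add[OF V] mem)
        (simp add: algebra_simps)
  next
    fix r x
    show "closest_point V (r *\<^sub>R x) = r *\<^sub>R closest_point V x"
      using orth[of _ x]
      by (intro closest_point_subspace_eqI[OF V] subspace_scale[OF V] mem)
        (simp add: inner_diff_left)
  qed
  then show ?thesis
    by (simp add: linear_conv_bounded_linear)
qed

text \<open>Turns convergence in the operator norm metric into convergence of the projections of
  each fixed vector.\<close>

lemma norm_closest_point_diff_le:
  assumes "subspace V" "subspace W"
  shows "norm (closest_point V x - closest_point W x) \<le> subspace_dist V W * norm x"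
  unfolding subspace_dist_def
  by (rule onorm[of "\<lambda>v. closest_point V v - closest_point W v"])
    (rule bounded_linear_sub[OF bounded_linear_closest_point bounded_linear_closest_point, OF assms])

text \<open>Any point of the fiber can replace the base point a, since the two differ by an element
  of V.\<close>

lemma raffine_of_dim_direction:
  assumes "raffine_of_dim p A"
  shows "rsubspace_of_dim p (direction A)"
    and "x \<in> A \<Longrightarrow> A = (+) x ` direction A"
proof -
  obtain a V where V: "rsubspace_of_dim p V" and A: "A = (+) a ` V"
    using assms by (auto simp: raffine_of_dim_def)
  have r: "rsubspace V" using V by (simp add: rsubspace_of_dim_def)
  have d: "direction A = V" unfolding A by (rule direction_translate_rsubspace[OF r])
  show "rsubspace_of_dim p (direction A)" using V d by simp
  assume "x \<in> A"
  then obtain v where v: "v \<in> V" "x = a + v" using A by auto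
  have add: "u + w \<in> V" if "u \<in> V" "w \<in> V" for u w
    using r that by (auto simp: rsubspace_def)
  have neg: "- w \<in> V" if "w \<in> V" for w
  proof -
    have "w *r (-1) \<in> V" using r that by (auto simp: rsubspace_def)
    moreover have "w *r (-1) = - w" by (simp add: rscale_def vec_eq_iff)
    ultimately show ?thesis by simp
  qed
  have eq: "a + w = x + (w + - v)" "x + w = a + (v + w)" for w
    using v by simp_all
  show "A = (+) x ` direction A"
    unfolding d unfolding A
  proof (intro equalityI image_subsetI)
    fix w assume "w \<in> V"
    then show "a + w \<in> (+) x ` V" "x + w \<in> (+) a ` V"
      using image_eqI[of "a + w" "(+) x" "w + - v" V] image_eqI[of "x + w" "(+) a" "v + w" V]
        eq[of w] add neg v(1) by blast+
  qed
qed

section \<open>Construction of the sections\<close>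

lemma independent_sections_if_skew_fibration:
  fixes \<F> :: "('f::{real_normed_div_algebra, euclidean_space} ^ 'n) set set"
  assumes pn: "p < CARD('n)" and q: "CARD('q::finite) = CARD('n) - p"
    and fib: "skew_fibration p \<F>"
  shows "\<exists>s :: nat \<Rightarrow> 'f ^ 'q \<Rightarrow> 'f ^ 'q. independent_sphere_tangent_sections p s"
proof -
  let ?n = "CARD('n)"
  have p_le: "p \<le> ?n" using pn by simp
  define A where "A = fiber_at \<F>"
  define D where "D x = direction (A x)" for x
  have A: "A x \<in> \<F>" "x \<in> A x" for x
  proof -
    have "\<exists>!B. B \<in> \<F> \<and> x \<in> B" using fib by (auto simp: skew_fibration_def)
    from theI'[OF this] show "A x \<in> \<F>" "x \<in> A x" by (simp_all add: A_def fiber_at_def)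
  qed
  have aff: "raffine_of_dim p (A x)" for x
    using A(1) fib by (auto simp: skew_fibration_def)
  have D: "rsubspace_of_dim p (D x)" and A_eq: "A x = (+) x ` D x" for x
    using raffine_of_dim_direction[OF aff] A(2) unfolding D_def by blast+
  have rD: "rsubspace (D x)" for x using D by (simp add: rsubspace_of_dim_def)
  have sD: "subspace (D x)" for x by (rule subspace_rsubspace[OF rD])
  have lim: "((\<lambda>y. subspace_dist (D y) (D x)) \<longlongrightarrow> 0) (at x)" for x
    using fib by (simp add: skew_fibration_def D_def A_def)
  have skew: "A x \<inter> A y = {}" "D x \<inter> D y = {0}" if "A x \<noteq> A y" for x y
  proof -
    have "\<forall>B\<in>\<F>. \<forall>C\<in>\<F>. B \<noteq> C \<longrightarrow> Defs.skew B C"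
      using fib by (simp add: skew_fibration_def)
    then have "Defs.skew (A x) (A y)" using A(1) that by blast
    then show "A x \<inter> A y = {}" "D x \<inter> D y = {0}" by (simp_all add: skew_def D_def)
  qed
  have A0: "A 0 = D 0" using A_eq[of 0] by simp
  obtain b0 where b0: "rindependent p b0" "rspan p b0 = D 0"
    using D[of 0] by (auto simp: rsubspace_of_dim_def)
  \<comment> \<open>The first p vectors span the direction of the fiber through 0; the others span a
    complement.\<close>
  obtain b where b_eq: "\<And>i. i < p \<Longrightarrow> b i = b0 i" and b: "rindependent ?n b" "rspan ?n b = UNIV"
    using rindependent_extend_basis[OF b0(1) p_le] by blast
  have b_mem: "b i \<in> D 0" if "i < p" for i
    using rspan_base[OF that, of b0] b0(2) b_eq[OF that] by simp
  obtain e where "e > 0" and e: "\<And>u. (\<And>i. i < p \<Longrightarrow> norm (b i - u i) < e) \<Longrightarrow> rindependent p u"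
    using rindependent_perturb[OF b p_le] by blast

  \<comment> \<open>The components of \<open>'f ^ 'q\<close> are matched with the basis indices from
    p on, so that \<open>L\<close> is onto the complement and \<open>\<pi>\<close> reads off the
    complementary coordinates.\<close>
  obtain \<sigma> :: "'q \<Rightarrow> nat" where \<sigma>: "bij_betw \<sigma> UNIV {p..<?n}"
    using finite_same_card_bij[of "UNIV :: 'q set" "{p..<?n}"] q by auto
  have \<sigma>_bounds: "p \<le> \<sigma> j" "\<sigma> j < ?n" for j
    using bij_betwE[OF \<sigma>] by auto
  define L :: "'f ^ 'q \<Rightarrow> 'f ^ 'n" where "L y = (\<Sum>j\<in>UNIV. b (\<sigma> j) *r (y $ j))" for y
  define \<pi> :: "'f ^ 'n \<Rightarrow> 'f ^ 'q" where "\<pi> x = (\<chi> j. rcoord ?n b x (\<sigma> j))" for x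
  have \<pi>_add: "\<pi> (x + y) = \<pi> x + \<pi> y" for x y
    by (simp add: \<pi>_def vec_eq_iff rcoord_add[OF b] \<sigma>_bounds)
  have \<pi>_rscale: "\<pi> (x *r c) = \<pi> x *r c" for x c
    by (simp add: \<pi>_def vec_eq_iff rcoord_rscale[OF b] \<sigma>_bounds rscale_nth)
  have \<pi>_sum: "\<pi> (\<Sum>i<p. u i *r c i) = (\<Sum>i<p. \<pi> (u i) *r c i)" for u c
  proof -
    have "\<pi> 0 = 0" using \<pi>_add[of 0 0] by simp
    then have "\<pi> (sum f {..<k}) = (\<Sum>i<k. \<pi> (f i))" for f and k :: nat
      by (induction k) (simp_all add: \<pi>_add)
    then show ?thesis by (simp add: \<pi>_rscale)
  qed
  have cont_\<pi>: "continuous_on UNIV \<pi>"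
    unfolding \<pi>_def
    by (intro continuous_on_vec_lambda linear_continuous_on bounded_linear_rcoord[OF b] \<sigma>_bounds)
  have cont_L: "continuous_on UNIV L"
    unfolding L_def by (intro continuous_intros rscale.continuous_on)
  have \<pi>_L: "\<pi> (L y) = y" for y
  proof -
    \<comment> \<open>The inverse of \<open>\<sigma>\<close> rewrites \<open>L y\<close> as a sum
      over all basis vectors, with coefficient 0 below p.\<close>
    define \<tau> where "\<tau> = inv_into UNIV \<sigma>"
    have \<tau>: "\<tau> (\<sigma> j) = j" for j
      using \<sigma> by (simp add: \<tau>_def bij_betw_def)
    have "L y = (\<Sum>i\<in>{p..<?n}. b i *r (y $ \<tau> i))"
      unfolding L_def by (rule sum.reindex_bij_betw[OF \<sigma>, of "\<lambda>i. b i *r (y $ \<tau> i)", unfolded \<tau>])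
    also have "\<dots> = (\<Sum>i<?n. b i *r (if p \<le> i then y $ \<tau> i else 0))"
      by (intro sum.mono_neutral_cong_left) (auto simp: rscale.zero_right)
    finally have "rcoord ?n b (L y) (\<sigma> j) = y $ j" for j
      using rcoord_unique[OF b, of "\<lambda>i. if p \<le> i then y $ \<tau> i else 0" "L y" "\<sigma> j"] \<sigma>_bounds
      by (simp add: \<tau>)
    then show ?thesis by (simp add: \<pi>_def vec_eq_iff)
  qed
  have \<pi>_b: "\<pi> (b i) = 0" if "i < p" for i
  proof -
    have "(\<Sum>k<?n. b k *r (if k = i then 1 else 0)) = b i"
      using that pn by (simp add: if_distrib[of "\<lambda>c. _ *r c"] rscale.zero_right cong: if_cong)
    from rcoord_unique[OF b this] that \<sigma>_bounds show ?thesis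
      by (auto simp: \<pi>_def vec_eq_iff) (metis linorder_not_less)
  qed
  have \<pi>_D0: "x \<in> D 0 \<longleftrightarrow> \<pi> x = 0" for x
  proof
    assume "x \<in> D 0"
    then obtain c where "x = (\<Sum>i<p. b i *r c i)"
      unfolding b0(2)[symmetric] rspan_def using b_eq by auto
    then show "\<pi> x = 0" using \<pi>_b by (simp add: \<pi>_sum rscale.zero_left)
  next
    assume 0: "\<pi> x = 0"
    have "rcoord ?n b x i = 0" if "p \<le> i" "i < ?n" for i
    proof -
      have "i \<in> range \<sigma>" using that by (simp add: bij_betw_imp_surj_on[OF \<sigma>])
      then obtain j where "i = \<sigma> j" by blast
      then show ?thesis using 0 by (simp add: \<pi>_def vec_eq_iff)
    qed
    then have "(\<Sum>i<?n. b i *r rcoord ?n b x i) = (\<Sum>i<p. b i *r rcoord ?n b x i)"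
      using pn by (intro sum.mono_neutral_right) (auto simp: rscale.zero_right)
    then have "x = (\<Sum>i<p. b i *r rcoord ?n b x i)"
      unfolding sum_rcoord[OF b] .
    also have "\<dots> \<in> D 0"
      by (rule sum_rscale_in_rsubspace[OF rD b_mem])
    finally show "x \<in> D 0" .
  qed

  define P where "P x v = closest_point (D x) v" for x v
  have P_mem: "P x v \<in> D x" for x v
    unfolding P_def using sD[of x] by (intro closest_point_in_set closed_subspace) (auto dest: subspace_0)
  have cont_P: "isCont (\<lambda>x. P x v) x" for x v
    unfolding isCont_def
  proof (rule Lim_null[THEN iffD2], rule Lim_null_comparison)
    show "\<forall>\<^sub>F y in at x. norm (P y v - P x v) \<le> subspace_dist (D y) (D x) * norm v"
      unfolding P_def by (intro always_eventually allI norm_closest_point_diff_le sD)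
    show "((\<lambda>y. subspace_dist (D y) (D x) * norm v) \<longlongrightarrow> 0) (at x)"
      by (rule tendsto_mult_left_zero[OF lim])
  qed
  have cont_u: "continuous_on UNIV (\<lambda>y. P (L y) v)" for v
    by (rule continuous_on_compose2[OF _ cont_L, of UNIV])
      (auto simp: continuous_on_eq_continuous_at cont_P)
  have P0: "P (L 0) (b i) = b i" if "i < p" for i
    using b_mem[OF that] by (simp add: P_def L_def rscale.zero_right closest_point_self)

  \<comment> \<open>At y = 0 the projections fix the b i, so by continuity they stay within the
    tolerance e of \<open>rindependent_perturb\<close> near 0.\<close>
  have "\<exists>r>0. \<forall>y. norm y \<le> r \<longrightarrow> (\<forall>i<p. norm (b i - P (L y) (b i)) < e)"
  proof -
    have "\<forall>\<^sub>F y in nhds 0. norm (b i - P (L y) (b i)) < e" if "i < p" for i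
    proof -
      have "isCont (\<lambda>y. norm (b i - P (L y) (b i))) 0"
        using cont_u[of "b i"] by (intro continuous_intros) (simp add: continuous_on_eq_continuous_at)
      then have "((\<lambda>y. norm (b i - P (L y) (b i))) \<longlongrightarrow> norm (b i - P (L 0) (b i))) (nhds 0)"
        unfolding isCont_def by (rule tendsto_at_iff_tendsto_nhds[THEN iffD1])
      then show ?thesis
        using \<open>e > 0\<close> by (rule_tac order_tendstoD(2)) (simp_all add: P0[OF that])
    qed
    then have "\<forall>\<^sub>F y in nhds 0. \<forall>i\<in>{..<p}. norm (b i - P (L y) (b i)) < e"
      by (intro eventually_ball_finite) auto
    then obtain d where "d > 0" "\<And>y. dist y 0 < d \<Longrightarrow> \<forall>i\<in>{..<p}. norm (b i - P (L y) (b i)) < e"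
      unfolding eventually_nhds_metric by blast
    \<comment> \<open>Halving d gives a closed ball, which contains the sphere of radius r used
      below.\<close>
    then show ?thesis by (intro exI[of _ "d / 2"]) auto
  qed
  then obtain r where "r > 0" and
    r: "\<And>y i. norm y \<le> r \<Longrightarrow> i < p \<Longrightarrow> norm (b i - P (L y) (b i)) < e" by blast

  have indep: "c = 0 \<and> (\<forall>i<p. t i = 0)"
    if y: "y \<noteq> 0" "norm y \<le> r" and eq: "(\<Sum>i<p. \<pi> (P (L y) (b i)) *r t i) + y *r c = 0" for y c t
  proof -
    define u where "u = (\<Sum>i<p. P (L y) (b i) *r t i)"
    have uD: "u \<in> D (L y)"
      unfolding u_def by (rule sum_rscale_in_rsubspace[OF rD P_mem])
    have \<pi>u: "\<pi> u + y *r c = 0" using eq by (simp add: u_def \<pi>_sum)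
    \<comment> \<open>The fiber through 0 is the kernel of \<open>\<pi>\<close>, while
      \<open>\<pi> (L y)\<close> is the nonzero y.\<close>
    have "L y \<notin> A 0" unfolding A0 by (simp add: \<pi>_D0 \<pi>_L y)
    then have ne: "A (L y) \<noteq> A 0" using A(2) by metis
    have "c = 0"
    proof (rule ccontr)
      assume c: "c \<noteq> 0"
      \<comment> \<open>Since \<open>\<pi> u = - (y *r c)\<close>, the point
        \<open>L y + u *r inverse c\<close> of the fiber through L y lies in the kernel of
        \<open>\<pi>\<close>, so the two fibers would meet.\<close>
      have "u *r inverse c \<in> D (L y)" using rD uD by (auto simp: rsubspace_def)
      then have "L y + u *r inverse c \<in> A (L y)" by (subst A_eq) auto
      moreover have "\<pi> (L y + u *r inverse c) = (\<pi> u + y *r c) *r inverse c"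
        using c by (simp add: \<pi>_add \<pi>_rscale \<pi>_L rscale.add_left rscale_rscale add.commute)
      then have "L y + u *r inverse c \<in> A 0"
        unfolding A0 by (simp add: \<pi>_D0 \<pi>u rscale.zero_left)
      ultimately show False using skew(1)[OF ne] by blast
    qed
    \<comment> \<open>With c = 0 the vector u lies in both directions and vanishes; independence of
      the projected vectors then kills the t i.\<close>
    with \<pi>u have "u \<in> D 0" by (simp add: \<pi>_D0 rscale.zero_right)
    with uD skew(2)[OF ne] have "u = 0" by blast
    moreover have "rindependent p (\<lambda>i. P (L y) (b i))" by (rule e, rule r[OF y(2)])
    ultimately show ?thesis using \<open>c = 0\<close> by (auto simp: rindependent_def u_def)
  qed

  \<comment> \<open>The factor r moves the unit sphere to the small sphere where
    \<open>indep\<close> applies.\<close>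
  define w where "w i y = \<pi> (P (L (r *\<^sub>R y)) (b i))" for i y
  define s where "s i y = w i y - y *r rline_coeff y (w i y)" for i y
  have cont_w: "continuous_on S (w i)" for S i
    unfolding w_def
    by (rule continuous_on_compose2[OF cont_\<pi>], rule continuous_on_compose2[OF cont_u])
      (auto intro!: continuous_intros)
  have "sphere_tangent_section (s i)" for i
    unfolding sphere_tangent_section_def s_def
    by (auto intro!: continuous_intros rscale.continuous_on continuous_on_rline_coeff cont_w
        diff_rline_coeff_tangent)
  moreover have "rindependent p (\<lambda>i. s i y)" if y: "y \<in> sphere 0 1" for y
    unfolding rindependent_def
  proof (rule allI, rule impI)
    fix t assume 0: "(\<Sum>i<p. s i y *r t i) = 0"
    \<comment> \<open>The components removed along yF add up to a single multiple of y, so a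
      relation among the sections is one among the w i and y.\<close>
    define c where "c = (\<Sum>i<p. rline_coeff y (w i y) * t i)"
    have "(\<Sum>i<p. w i y *r t i) - y *r c = 0"
      using 0 by (simp add: s_def c_def rscale.diff_left sum_subtractf rscale_rscale rscale.sum_right)
    \<comment> \<open>Dividing c by r compensates for the passage from y to
      \<open>r *\<^sub>R y\<close>.\<close>
    moreover have "(r *\<^sub>R y) *r (- (c /\<^sub>R r)) = - (y *r c)"
      using \<open>r > 0\<close> by (simp add: rscale.scaleR_left rscale.scaleR_right rscale.minus_right)
    ultimately have "(\<Sum>i<p. \<pi> (P (L (r *\<^sub>R y)) (b i)) *r t i) + (r *\<^sub>R y) *r (- (c /\<^sub>R r)) = 0"
      by (simp add: w_def)
    then show "\<forall>i<p. t i = 0"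
      using indep[of "r *\<^sub>R y"] y \<open>r > 0\<close> by fastforce
  qed
  ultimately show ?thesis
    unfolding independent_sphere_tangent_sections_def by blast
qed

theorem theorem5:
  fixes p :: nat
  assumes "1 \<le> p"
    and "p < CARD('n::finite)"
    and "CARD('q::finite) = CARD('n) - p"
  shows "((\<exists>\<F> :: (real ^ 'n) set set. skew_fibration p \<F>) \<longrightarrow>
            (\<exists>s :: nat \<Rightarrow> real ^ 'q \<Rightarrow> real ^ 'q. independent_sphere_tangent_sections p s))
       \<and> ((\<exists>\<F> :: (complex ^ 'n) set set. skew_fibration p \<F>) \<longrightarrow>
            (\<exists>s :: nat \<Rightarrow> complex ^ 'q \<Rightarrow> complex ^ 'q. independent_sphere_tangent_sections p s))
       \<and> ((\<exists>\<F> :: (quat ^ 'n) set set. skew_fibration p \<F>) \<longrightarrow>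
            (\<exists>s :: nat \<Rightarrow> quat ^ 'q \<Rightarrow> quat ^ 'q. independent_sphere_tangent_sections p s))"
  by (intro conjI impI; elim exE; rule independent_sections_if_skew_fibration[OF assms(2,3)])

end
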